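(* Let $S$ be a commutative semiring with a nonzero identity and $M$ a unital $S$-semimodule. Let $q:\operatorname{Sub}(M)\to\operatorname{Id}(S)$ be the function $q(N)=[N:M]$, where $\operatorname{Id}(S)$ is the commutative semigroup of ideals of $S$ under multiplication of ideals. If the graph $\Gamma_{(\operatorname{Id}(S),q)}(\operatorname{Sub}(M))$ is non-empty, then it is a connected graph whose diameter is at most $3$.
   Context: A commutative semiring with identity $(S,+,\cdot,0,1)$ consists of commutative monoids $(S,+,0)$ and $(S,\cdot,1)$ with multiplication distributing over addition and $0\cdot s=0$ for all $s$. A unital $S$-semimodule $M$ is a commutative additive monoid with a bi-additive action of $S$ satisfying $(st)m=s(tm)$, $1m=m$, $0_S m=0_M$ and $s0_M=0_M$. $\operatorname{Sub}(M)$ is the set of all $S$-subsemimodules of $M$. An ideal of $S$ is a non-empty subset closed under addition and under multiplication by elements of $S$; $\operatorname{Id}(S)$ is the set of all ideals of $S$. The product $IJ$ of ideals is the set of finite sums of products $ab$ with $a\in I$, $b\in J$; the zero of the semigroup $\operatorname{Id}(S)$ under this product is $(0)$. For a subsemimodule $N$ of $M$, $[N:M]=\{s\in S: sM\subseteq N\}$, which is an ideal of $S$. For a non-empty set $X$, a commutative semigroup with zero $(T,\cdot,0)$ and a function $f:X\to T$, the simple graph $\Gamma_{(T,f)}(X)$ is defined as follows. An element $x\in X$ is a vertex if $f(x)\neq 0$ and there is a $y\in X$ with $y\neq x$, $f(y)\neq 0$ and $f(x)\cdot f(y)=0$. For $x,y\in X$, $\{x,y\}$ is an edge if $x\neq y$,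 $f(x)\neq 0$, $f(y)\neq 0$ and $f(x)\cdot f(y)=0$. The graph is non-empty if it has at least one vertex; its diameter is the greatest distance between any two vertices, distance being the number of edges in a shortest path. *)

theory Defs
  imports "HOL-Algebra.Module" "HOL-Algebra.Ideal_Product" "Graph_Theory.Graph_Theory"
begin

section \<open>Commutative semirings, semimodules, ideals\<close>

locale nonzero_comm_semiring = semiring R + comm_monoid R for R (structure) +
  assumes one_not_zero: "\<one> \<noteq> \<zero>"

text \<open>
  As for the locale \<^verbatim>\<open>module\<close>, the multiplicative fields of the record \<^verbatim>\<open>M\<close> are irrelevant.
\<close>
locale semimodule = R?: nonzero_comm_semiring R + M?: abelian_monoid M
  for R :: "('a, 'c) ring_scheme" (structure) and M :: "('a, 'b, 'd) module_scheme" (structure) +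
  assumes smult_closed [simp, intro]:
      "\<lbrakk>a \<in> carrier R; x \<in> carrier M\<rbrakk> \<Longrightarrow> a \<odot>\<^bsub>M\<^esub> x \<in> carrier M"
    and smult_l_distr:
      "\<lbrakk>a \<in> carrier R; b \<in> carrier R; x \<in> carrier M\<rbrakk> \<Longrightarrow>
        (a \<oplus>\<^bsub>R\<^esub> b) \<odot>\<^bsub>M\<^esub> x = a \<odot>\<^bsub>M\<^esub> x \<oplus>\<^bsub>M\<^esub> b \<odot>\<^bsub>M\<^esub> x"
    and smult_r_distr:
      "\<lbrakk>a \<in> carrier R; x \<in> carrier M; y \<in> carrier M\<rbrakk> \<Longrightarrow>
        a \<odot>\<^bsub>M\<^esub> (x \<oplus>\<^bsub>M\<^esub> y) = a \<odot>\<^bsub>M\<^esub> x \<oplus>\<^bsub>M\<^esub> a \<odot>\<^bsub>M\<^esub> y"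
    and smult_assoc:
      "\<lbrakk>a \<in> carrier R; b \<in> carrier R; x \<in> carrier M\<rbrakk> \<Longrightarrow>
        (a \<otimes>\<^bsub>R\<^esub> b) \<odot>\<^bsub>M\<^esub> x = a \<odot>\<^bsub>M\<^esub> (b \<odot>\<^bsub>M\<^esub> x)"
    and smult_one [simp]: "x \<in> carrier M \<Longrightarrow> \<one>\<^bsub>R\<^esub> \<odot>\<^bsub>M\<^esub> x = x"
    and smult_l_null [simp]: "x \<in> carrier M \<Longrightarrow> \<zero>\<^bsub>R\<^esub> \<odot>\<^bsub>M\<^esub> x = \<zero>\<^bsub>M\<^esub>"
    and smult_r_null [simp]: "a \<in> carrier R \<Longrightarrow> a \<odot>\<^bsub>M\<^esub> \<zero>\<^bsub>M\<^esub> = \<zero>\<^bsub>M\<^esub>"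

locale subsemimodule = submonoid N "add_monoid M"
  for N and R :: "('a, 'c) ring_scheme" and M :: "('a, 'b, 'd) module_scheme" (structure) +
  assumes smult_closed: "\<lbrakk>a \<in> carrier R; x \<in> N\<rbrakk> \<Longrightarrow> a \<odot>\<^bsub>M\<^esub> x \<in> N"

definition Sub :: "('a, 'c) ring_scheme \<Rightarrow> ('a, 'b, 'd) module_scheme \<Rightarrow> 'b set set" where
  "Sub R M = {N. subsemimodule N R M}"

definition semiring_ideal :: "'a set \<Rightarrow> ('a, 'c) ring_scheme \<Rightarrow> bool" where
  "semiring_ideal I R \<longleftrightarrow> I \<subseteq> carrier R \<and> I \<noteq> {} \<and>
    (\<forall>a\<in>I. \<forall>b\<in>I. a \<oplus>\<^bsub>R\<^esub> b \<in> I) \<and> (\<forall>s\<in>carrier R. \<forall>a\<in>I. s \<otimes>\<^bsub>R\<^esub> a \<in> I)"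

text \<open>
  The analogue for semirings of the library's \<^const>\<open>ideals_set\<close>, which is restricted to ideals of
  rings. Only carrier, multiplication and zero are used below.
\<close>
definition Id_semigroup :: "('a, 'c) ring_scheme \<Rightarrow> 'a set ring" where
  "Id_semigroup R = \<lparr> carrier = {I. semiring_ideal I R},
     monoid.mult = ideal_prod R, one = carrier R, zero = {\<zero>\<^bsub>R\<^esub>}, add = set_add R \<rparr>"

definition residual :: "('a, 'c) ring_scheme \<Rightarrow> ('a, 'b, 'd) module_scheme \<Rightarrow> 'b set \<Rightarrow> 'a set" where
  "residual R M N = {s \<in> carrier R. (\<lambda>m. s \<odot>\<^bsub>M\<^esub> m) ` carrier M \<subseteq> N}"


section \<open>The graph attached to a function into a commutative semigroup with zero\<close>

locale comm_semigroup_with_zero = fixes T (structure)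
  assumes m_closed: "\<lbrakk>a \<in> carrier T; b \<in> carrier T\<rbrakk> \<Longrightarrow> a \<otimes> b \<in> carrier T"
    and m_assoc: "\<lbrakk>a \<in> carrier T; b \<in> carrier T; c \<in> carrier T\<rbrakk> \<Longrightarrow> (a \<otimes> b) \<otimes> c = a \<otimes> (b \<otimes> c)"
    and m_comm: "\<lbrakk>a \<in> carrier T; b \<in> carrier T\<rbrakk> \<Longrightarrow> a \<otimes> b = b \<otimes> a"
    and zero_closed: "\<zero> \<in> carrier T"
    and l_null: "a \<in> carrier T \<Longrightarrow> \<zero> \<otimes> a = \<zero>"

text \<open>
  Following \<^verbatim>\<open>Graph_Theory\<close>, an undirected simple graph is represented by a symmetric loop-free
  digraph: the edge \<^verbatim>\<open>{x, y}\<close> is the pair of arcs \<^verbatim>\<open>(x, y)\<close> and \<^verbatim>\<open>(y, x)\<close>.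
\<close>
definition \<Gamma> :: "('t, 'c) ring_scheme \<Rightarrow> ('x \<Rightarrow> 't) \<Rightarrow> 'x set \<Rightarrow> 'x pair_pre_digraph" where
  "\<Gamma> T f X = \<lparr>
     pverts = {x \<in> X. f x \<noteq> \<zero>\<^bsub>T\<^esub> \<and>
                 (\<exists>y\<in>X. y \<noteq> x \<and> f y \<noteq> \<zero>\<^bsub>T\<^esub> \<and> f x \<otimes>\<^bsub>T\<^esub> f y = \<zero>\<^bsub>T\<^esub>)},
     parcs = {(x, y). x \<in> X \<and> y \<in> X \<and> x \<noteq> y \<and> f x \<noteq> \<zero>\<^bsub>T\<^esub> \<and> f y \<noteq> \<zero>\<^bsub>T\<^esub> \<and>
                 f x \<otimes>\<^bsub>T\<^esub> f y = \<zero>\<^bsub>T\<^esub>} \<rparr>"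

text \<open>
  With unit weights, the library's \<^verbatim>\<open>\<mu>\<close> is the least number of arcs of a walk, and \<open>\<infinity>\<close> if there
  is none.
\<close>
definition graph_dist :: "'x pair_pre_digraph \<Rightarrow> 'x \<Rightarrow> 'x \<Rightarrow> ereal" where
  "graph_dist G u v = wf_digraph.\<mu> (with_proj G) (\<lambda>_. 1) u v"

definition graph_diameter :: "'x pair_pre_digraph \<Rightarrow> ereal" where
  "graph_diameter G = (SUP u\<in>pverts G. SUP v\<in>pverts G. graph_dist G u v)"


section \<open>The objects above have the structure claimed for them\<close>

lemma (in comm_semigroup_with_zero) \<Gamma>_simple_graph:
  assumes "f ` X \<subseteq> carrier T"
  shows "pair_bidirected_digraph (\<Gamma> T f X)"
proof -
  have comm: "f x \<otimes> f y = f y \<otimes> f x" if "x \<in> X" "y \<in> X" for x y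
    using assms that by (intro m_comm) auto
  have arc: "(y, x) \<in> parcs (\<Gamma> T f X) \<and> x \<in> pverts (\<Gamma> T f X)"
    if "(x, y) \<in> parcs (\<Gamma> T f X)" for x y
    using that comm[of x y] by (fastforce simp: \<Gamma>_def)
  have no_loop: "x \<noteq> y" if "(x, y) \<in> parcs (\<Gamma> T f X)" for x y
    using that by (simp add: \<Gamma>_def)
  show ?thesis
  proof unfold_locales
    show "symmetric (with_proj (\<Gamma> T f X))"
      using arc by (auto simp: symmetric_def intro: symI)
  next
    fix e assume e: "e \<in> parcs (\<Gamma> T f X)"
    obtain x y where xy: "e = (x, y)" by (cases e)
    show "fst e \<in> pverts (\<Gamma> T f X)" using arc[of x y] e xy by simp
    show "snd e \<in> pverts (\<Gamma> T f X)" using arc[of x y] arc[of y x] e xy by simp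
    show "fst e \<noteq> snd e" using no_loop[of x y] e xy by simp
  qed
qed

context nonzero_comm_semiring
begin

lemma semiring_ideal_zero:
  assumes "semiring_ideal I R" shows "\<zero> \<in> I"
proof -
  obtain a where "a \<in> I" using assms by (auto simp: semiring_ideal_def)
  moreover from this have "\<zero> \<otimes> a \<in> I" "a \<in> carrier R"
    using assms by (auto simp: semiring_ideal_def)
  ultimately show ?thesis by simp
qed

lemma ideal_prod_carrier:
  assumes "I \<subseteq> carrier R" "J \<subseteq> carrier R" shows "ideal_prod R I J \<subseteq> carrier R"
proof
  fix x assume "x \<in> ideal_prod R I J"
  then show "x \<in> carrier R" by induction (use assms in auto)
qed

lemma ideal_prod_comm_sub:
  assumes "I \<subseteq> carrier R" "J \<subseteq> carrier R" shows "ideal_prod R I J \<subseteq> ideal_prod R J I"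
proof
  fix x assume "x \<in> ideal_prod R I J"
  then show "x \<in> ideal_prod R J I"
  proof induction
    case (prod i j)
    then have "i \<otimes> j = j \<otimes> i" using assms by (intro m_comm) auto
    then show ?case using prod by (simp add: ideal_prod.prod)
  qed (rule ideal_prod.sum)
qed

lemma ideal_prod_comm:
  assumes "I \<subseteq> carrier R" "J \<subseteq> carrier R" shows "ideal_prod R I J = ideal_prod R J I"
  using ideal_prod_comm_sub assms by blast

lemma ideal_prod_assoc_sub:
  assumes "I \<subseteq> carrier R" "J \<subseteq> carrier R" "K \<subseteq> carrier R"
  shows "ideal_prod R (ideal_prod R I J) K \<subseteq> ideal_prod R I (ideal_prod R J K)"
proof
  have *: "x \<otimes> k \<in> ideal_prod R I (ideal_prod R J K)" if "x \<in> ideal_prod R I J" "k \<in> K" for x k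
    using that(1)
  proof induction
    case (prod i j)
    then have "(i \<otimes> j) \<otimes> k = i \<otimes> (j \<otimes> k)" using assms that by (intro m_assoc) auto
    then show ?case using prod that(2) by (simp add: ideal_prod.prod)
  next
    case (sum s1 s2)
    then have "(s1 \<oplus> s2) \<otimes> k = s1 \<otimes> k \<oplus> s2 \<otimes> k"
      using assms that ideal_prod_carrier[of I J] by (intro l_distr) auto
    then show ?case using sum by (simp add: ideal_prod.sum)
  qed
  fix x assume "x \<in> ideal_prod R (ideal_prod R I J) K"
  then show "x \<in> ideal_prod R I (ideal_prod R J K)"
    by induction (auto intro: * ideal_prod.sum)
qed

lemma ideal_prod_assoc:
  assumes "I \<subseteq> carrier R" "J \<subseteq> carrier R" "K \<subseteq> carrier R"
  shows "ideal_prod R (ideal_prod R I J) K = ideal_prod R I (ideal_prod R J K)"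
proof
  have "ideal_prod R I (ideal_prod R J K) = ideal_prod R (ideal_prod R K J) I"
    using assms by (metis ideal_prod_comm ideal_prod_carrier)
  also have "\<dots> \<subseteq> ideal_prod R K (ideal_prod R J I)"
    using assms by (intro ideal_prod_assoc_sub)
  also have "\<dots> = ideal_prod R (ideal_prod R I J) K"
    using assms by (metis ideal_prod_comm ideal_prod_carrier)
  finally show "ideal_prod R I (ideal_prod R J K) \<subseteq> ideal_prod R (ideal_prod R I J) K" .
qed (use assms in \<open>rule ideal_prod_assoc_sub\<close>)

lemma ideal_prod_semiring_ideal:
  assumes "semiring_ideal I R" "semiring_ideal J R"
  shows "semiring_ideal (ideal_prod R I J) R"
proof -
  have c: "I \<subseteq> carrier R" "J \<subseteq> carrier R" using assms by (auto simp: semiring_ideal_def)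
  have "\<zero> \<otimes> \<zero> \<in> ideal_prod R I J"
    using assms by (intro ideal_prod.prod semiring_ideal_zero)
  moreover have "s \<otimes> x \<in> ideal_prod R I J" if s: "s \<in> carrier R" and "x \<in> ideal_prod R I J" for s x
    using that(2)
  proof induction
    case (prod i j)
    then have "s \<otimes> (i \<otimes> j) = (s \<otimes> i) \<otimes> j" using c s by (intro m_assoc[symmetric]) auto
    moreover have "s \<otimes> i \<in> I" using assms(1) s prod by (auto simp: semiring_ideal_def)
    ultimately show ?case using prod by (simp add: ideal_prod.prod)
  next
    case (sum s1 s2)
    then have "s \<otimes> (s1 \<oplus> s2) = s \<otimes> s1 \<oplus> s \<otimes> s2"
      using c s ideal_prod_carrier[of I J] by (intro r_distr) auto
    then show ?case using sum by (simp add: ideal_prod.sum)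
  qed
  ultimately show ?thesis
    using ideal_prod_carrier[OF c] by (auto simp: semiring_ideal_def intro: ideal_prod.sum)
qed

lemma ideal_prod_zero:
  assumes "semiring_ideal I R" shows "ideal_prod R {\<zero>} I = {\<zero>}"
proof
  show "ideal_prod R {\<zero>} I \<subseteq> {\<zero>}"
  proof
    fix x assume "x \<in> ideal_prod R {\<zero>} I"
    then show "x \<in> {\<zero>}"
      by induction (use assms in \<open>auto simp: semiring_ideal_def\<close>)
  qed
  have "\<zero> \<otimes> \<zero> \<in> ideal_prod R {\<zero>} I"
    using semiring_ideal_zero[OF assms] by (intro ideal_prod.prod) simp_all
  then show "{\<zero>} \<subseteq> ideal_prod R {\<zero>} I" by simp
qed

lemma Id_comm_semigroup_with_zero: "comm_semigroup_with_zero (Id_semigroup R)"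
proof unfold_locales
  have "semiring_ideal {\<zero>} R" by (simp add: semiring_ideal_def)
  then show "\<zero>\<^bsub>Id_semigroup R\<^esub> \<in> carrier (Id_semigroup R)"
    by (simp add: Id_semigroup_def)
qed (auto simp: Id_semigroup_def ideal_prod_semiring_ideal ideal_prod_zero,
     auto simp: semiring_ideal_def ideal_prod_assoc ideal_prod_comm)

end

lemma (in semimodule) residual_in_Id:
  assumes "N \<in> Sub R M" shows "residual R M N \<in> carrier (Id_semigroup R)"
proof -
  interpret N: subsemimodule N R M using assms by (simp add: Sub_def)
  have N: "\<zero>\<^bsub>M\<^esub> \<in> N" "\<And>x y. x \<in> N \<Longrightarrow> y \<in> N \<Longrightarrow> x \<oplus>\<^bsub>M\<^esub> y \<in> N"
    using N.one_closed N.m_closed by simp_all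
  have "\<zero>\<^bsub>R\<^esub> \<in> residual R M N" using N by (auto simp: residual_def)
  moreover have "a \<oplus>\<^bsub>R\<^esub> b \<in> residual R M N"
    if "a \<in> residual R M N" "b \<in> residual R M N" for a b
    using that N by (simp add: residual_def image_subset_iff smult_l_distr)
  moreover have "s \<otimes>\<^bsub>R\<^esub> a \<in> residual R M N"
    if "s \<in> carrier R" "a \<in> residual R M N" for s a
    using that N.smult_closed by (simp add: residual_def image_subset_iff smult_assoc)
  ultimately show ?thesis
    by (auto simp: Id_semigroup_def semiring_ideal_def) (simp add: residual_def)
qed

end

theory Submission
  imports Defs
begin

text \<open>
  The argument known from zero-divisor graphs of commutative rings applies. Given distinct
  non-adjacent vertices \<open>x\<close> and \<open>y\<close>, choose a neighbour \<open>a\<close> of \<open>x\<close> and a neighbour \<open>b\<close> of \<open>y\<close>.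
  If \<open>f a \<cdot> f b = 0\<close>, the walk \<open>x, a, b, y\<close> (or \<open>x, a, y\<close> when \<open>a = b\<close>) has length at most 3.
  Otherwise, in a ring, the product \<open>ab\<close> would be a common neighbour of \<open>x\<close> and \<open>y\<close>. In general
  \<open>X\<close> has no product, but any \<open>c\<close> with \<open>f c \<noteq> 0\<close> that is annihilated by everything annihilating
  \<open>f a\<close> or \<open>f b\<close> can take its place (lemma \<open>\<Gamma>_connected_diameter_le_3\<close>).

  For subsemimodules the intersection \<open>A \<inter> B\<close> is such an element: \<open>[A \<inter> B : M]\<close> equals
  \<open>[A : M] \<inter> [B : M]\<close> (\<open>residual_Int\<close>). It is nonzero because it contains the nonzero product
  \<open>[A : M] [B : M]\<close> (\<open>ideal_prod_subset_Int\<close>), and every ideal annihilating \<open>[A : M]\<close> or \<open>[B : M]\<close>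
  annihilates it because it is contained in both (\<open>ideal_prod_eq_zero_mono\<close>).
\<close>

text \<open>
  The distance is an infimum over all walks, so one short walk bounds it. Connectedness refers to
  the symmetrised digraph, which here has the same reachability relation because arcs come in
  opposite pairs.
\<close>
lemma connected_diameter_leI:
  assumes "pair_bidirected_digraph G" and "pverts G \<noteq> {}"
    and walk: "\<And>u v. \<lbrakk>u \<in> pverts G; v \<in> pverts G\<rbrakk> \<Longrightarrow>
      \<exists>p. pre_digraph.awalk (with_proj G) u p v \<and> length p \<le> k"
  shows "Digraph_Component.connected (with_proj G) \<and> graph_diameter G \<le> ereal (real k)"
proof
  interpret pair_bidirected_digraph G by fact
  have "u \<rightarrow>\<^sup>*\<^bsub>with_proj G\<^esub> v" if "u \<in> pverts G" "v \<in> pverts G" for u v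
    using walk[OF that] by (auto simp: reachable_awalk)
  then show "Digraph_Component.connected (with_proj G)"
    unfolding connected_def
    using assms(2) reachable_mk_symmetric_eq[OF sym_arcs] by (intro strongly_connectedI) auto
  have "graph_dist G u v \<le> ereal (real k)" if uv: "u \<in> pverts G" "v \<in> pverts G" for u v
  proof -
    obtain p where p: "awalk u p v" "length p \<le> k" using walk[OF uv] by blast
    have "graph_dist G u v \<le> ereal (awalk_cost (\<lambda>_. 1) p)"
      unfolding graph_dist_def by (rule min_cost_le_walk_cost[OF p(1)])
    also have "\<dots> = ereal (real (length p))"
      by (simp add: awalk_cost_def sum_list_triv)
    also have "\<dots> \<le> ereal (real k)" using p(2) by simp
    finally show ?thesis .
  qed
  then show "graph_diameter G \<le> ereal (real k)"
    unfolding graph_diameter_def by (intro SUP_least)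
qed

text \<open>
  The element \<open>c\<close> replaces the product of \<open>a\<close> and \<open>b\<close>: it is a common neighbour of \<open>x\<close>
  and \<open>y\<close> when \<open>a\<close> is adjacent to \<open>x\<close>, \<open>b\<close> is adjacent to \<open>y\<close>, and \<open>f x \<cdot> f y \<noteq> 0\<close>.
\<close>
lemma (in comm_semigroup_with_zero) \<Gamma>_connected_diameter_le_3:
  assumes f: "f ` X \<subseteq> carrier T" and ne: "pverts (\<Gamma> T f X) \<noteq> {}"
    and meet: "\<And>a b. \<lbrakk>a \<in> X; b \<in> X; f a \<otimes> f b \<noteq> \<zero>\<rbrakk> \<Longrightarrow>
      \<exists>c\<in>X. f c \<noteq> \<zero> \<and> (\<forall>t\<in>carrier T. t \<otimes> f a = \<zero> \<or> t \<otimes> f b = \<zero> \<longrightarrow> t \<otimes> f c = \<zero>)"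
  shows "Digraph_Component.connected (with_proj (\<Gamma> T f X)) \<and> graph_diameter (\<Gamma> T f X) \<le> 3"
proof -
  define G where "G = \<Gamma> T f X"
  interpret pair_bidirected_digraph G
    unfolding G_def by (rule \<Gamma>_simple_graph[OF f])
  have comm: "f x \<otimes> f y = f y \<otimes> f x" if "x \<in> X" "y \<in> X" for x y
    using f that by (intro m_comm) auto
  have vertD: "x \<in> X" "f x \<noteq> \<zero>" "\<exists>y. (x, y) \<in> parcs G" if "x \<in> pverts G" for x
    using that by (auto simp: G_def \<Gamma>_def)
  have arc_iff: "(x, y) \<in> parcs G \<longleftrightarrow> x \<in> X \<and> y \<in> X \<and> x \<noteq> y \<and> f x \<noteq> \<zero> \<and> f y \<noteq> \<zero> \<and>
      f x \<otimes> f y = \<zero>" for x y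
    by (simp add: G_def \<Gamma>_def)
  have arc_sym: "(y, x) \<in> parcs G" if "(x, y) \<in> parcs G" for x y
    using that comm[of x y] by (auto simp: arc_iff)
  have verts: "x \<in> pverts G" "y \<in> pverts G" if "(x, y) \<in> parcs G" for x y
    using arc_fst_in_verts[OF that] arc_snd_in_verts[OF that] by simp_all
  have "\<exists>p. awalk x p y \<and> length p \<le> 3" if x: "x \<in> pverts G" and y: "y \<in> pverts G" for x y
  proof -
    have two: ?thesis if "(x, c) \<in> parcs G" "(c, y) \<in> parcs G" for c
      using that verts by (intro exI[of _ "[(x, c), (c, y)]"]) (simp add: awalk_simps x y)
    consider "x = y" | "(x, y) \<in> parcs G" | "x \<noteq> y" "f x \<otimes> f y \<noteq> \<zero>"
      using vertD[OF x] vertD[OF y] arc_iff by blast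
    then show ?thesis
    proof cases
      case 1
      then show ?thesis using x by (intro exI[of _ "[]"]) (simp add: awalk_simps)
    next
      case 2
      then show ?thesis using y by (intro exI[of _ "[(x, y)]"]) (simp add: awalk_simps x)
    next
      case 3
      obtain a b where xa: "(x, a) \<in> parcs G" and yb: "(y, b) \<in> parcs G"
        using vertD[OF x] vertD[OF y] by blast
      consider "a = b" | "(a, b) \<in> parcs G" | "f a \<otimes> f b \<noteq> \<zero>"
        using xa yb arc_iff by blast
      then show ?thesis
      proof cases
        case 1
        then show ?thesis using two xa arc_sym[OF yb] by blast
      next
        case 2
        then show ?thesis using xa arc_sym[OF yb] verts
          by (intro exI[of _ "[(x, a), (a, b), (b, y)]"]) (simp add: awalk_simps x y)
      next
        case ab: 3
        obtain c where c: "c \<in> X" "f c \<noteq> \<zero>"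
          and ann: "\<And>t. \<lbrakk>t \<in> carrier T; t \<otimes> f a = \<zero> \<or> t \<otimes> f b = \<zero>\<rbrakk> \<Longrightarrow> t \<otimes> f c = \<zero>"
          using meet[OF _ _ ab] xa yb arc_iff by blast
        have xc: "f x \<otimes> f c = \<zero>" and yc: "f y \<otimes> f c = \<zero>"
          using ann xa yb f arc_iff by blast+
        \<comment> \<open>If \<open>c\<close> were \<open>x\<close> or \<open>y\<close>, these products would make \<open>x\<close> and \<open>y\<close> adjacent.\<close>
        have "c \<noteq> x" "c \<noteq> y"
          using xc yc 3(2) comm[of x y] vertD(1)[OF x] vertD(1)[OF y] by auto
        then have "(x, c) \<in> parcs G" "(y, c) \<in> parcs G"
          using c xc yc vertD[OF x] vertD[OF y] arc_iff by auto
        then show ?thesis using two arc_sym by blast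
      qed
    qed
  qed
  then show ?thesis
    using connected_diameter_leI[of G 3] ne pair_bidirected_digraph_axioms by (simp add: G_def)
qed

context nonzero_comm_semiring
begin

lemma ideal_prod_subset_Int:
  assumes "semiring_ideal I R" "semiring_ideal J R"
  shows "ideal_prod R I J \<subseteq> I \<inter> J"
proof
  fix x assume "x \<in> ideal_prod R I J"
  then show "x \<in> I \<inter> J"
  proof induction
    case (prod i j)
    then have "i \<in> carrier R" "j \<in> carrier R" "i \<otimes> j = j \<otimes> i"
      using assms by (auto simp: semiring_ideal_def intro!: m_comm)
    then show ?case using assms prod by (auto simp: semiring_ideal_def) metis
  next
    case (sum s1 s2)
    then show ?case using assms by (simp add: semiring_ideal_def)
  qed
qed

lemma ideal_prod_mono:
  assumes "J \<subseteq> J'" shows "ideal_prod R I J \<subseteq> ideal_prod R I J'"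
proof
  fix x assume "x \<in> ideal_prod R I J"
  then show "x \<in> ideal_prod R I J'"
    by induction (use assms in \<open>auto intro: ideal_prod.intros\<close>)
qed

lemma ideal_prod_eq_zero_mono:
  assumes "semiring_ideal I R" "semiring_ideal J R" "J \<subseteq> J'" "ideal_prod R I J' = {\<zero>}"
  shows "ideal_prod R I J = {\<zero>}"
  using ideal_prod_mono[OF assms(3), of I] assms(4)
    semiring_ideal_zero[OF ideal_prod_semiring_ideal[OF assms(1,2)]] by blast

end

lemma subsemimodule_Int:
  assumes "subsemimodule A R M" "subsemimodule B R M"
  shows "subsemimodule (A \<inter> B) R M"
proof -
  interpret A: subsemimodule A R M by fact
  interpret B: subsemimodule B R M by fact
  show ?thesis
    by unfold_locales
      (use A.subset A.m_closed B.m_closed A.one_closed B.one_closed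
        A.smult_closed B.smult_closed in auto)
qed

lemma residual_Int: "residual R M (A \<inter> B) = residual R M A \<inter> residual R M B"
  by (auto simp: residual_def)

theorem corollary3p12:
  fixes S :: "('a, 'c) ring_scheme" and M :: "('a, 'b, 'd) module_scheme"
  assumes "semimodule S M"
    and "pverts (\<Gamma> (Id_semigroup S) (residual S M) (Sub S M)) \<noteq> {}"
  shows "Digraph_Component.connected (with_proj (\<Gamma> (Id_semigroup S) (residual S M) (Sub S M)))
    \<and> graph_diameter (\<Gamma> (Id_semigroup S) (residual S M) (Sub S M)) \<le> 3"
proof -
  interpret semimodule S M by fact
  interpret Id: comm_semigroup_with_zero "Id_semigroup S" by (rule R.Id_comm_semigroup_with_zero)
  have ideal: "semiring_ideal (residual S M N) S" if "N \<in> Sub S M" for N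
    using residual_in_Id[OF that] by (simp add: Id_semigroup_def)
  show ?thesis
  proof (rule Id.\<Gamma>_connected_diameter_le_3[OF _ assms(2)])
    show "residual S M ` Sub S M \<subseteq> carrier (Id_semigroup S)"
      using residual_in_Id by blast
  next
    fix A B assume AB: "A \<in> Sub S M" "B \<in> Sub S M"
      and nz: "residual S M A \<otimes>\<^bsub>Id_semigroup S\<^esub> residual S M B \<noteq> \<zero>\<^bsub>Id_semigroup S\<^esub>"
    have C: "A \<inter> B \<in> Sub S M" using AB by (simp add: Sub_def subsemimodule_Int)
    have "ideal_prod S (residual S M A) (residual S M B) \<subseteq> residual S M (A \<inter> B)"
      using R.ideal_prod_subset_Int ideal AB by (simp add: residual_Int)
    moreover have "\<zero>\<^bsub>S\<^esub> \<in> ideal_prod S (residual S M A) (residual S M B)"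
      by (intro R.semiring_ideal_zero R.ideal_prod_semiring_ideal ideal AB)
    ultimately have "residual S M (A \<inter> B) \<noteq> {\<zero>\<^bsub>S\<^esub>}"
      using nz by (auto simp: Id_semigroup_def)
    moreover have "ideal_prod S I (residual S M (A \<inter> B)) = {\<zero>\<^bsub>S\<^esub>}"
      if "semiring_ideal I S" "ideal_prod S I (residual S M A) = {\<zero>\<^bsub>S\<^esub>} \<or>
        ideal_prod S I (residual S M B) = {\<zero>\<^bsub>S\<^esub>}" for I
      using that R.ideal_prod_eq_zero_mono[OF that(1) ideal[OF C]] residual_Int[of S M A B] by blast
    ultimately show "\<exists>C\<in>Sub S M. residual S M C \<noteq> \<zero>\<^bsub>Id_semigroup S\<^esub> \<and>
        (\<forall>I\<in>carrier (Id_semigroup S).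
          I \<otimes>\<^bsub>Id_semigroup S\<^esub> residual S M A = \<zero>\<^bsub>Id_semigroup S\<^esub> \<or>
          I \<otimes>\<^bsub>Id_semigroup S\<^esub> residual S M B = \<zero>\<^bsub>Id_semigroup S\<^esub> \<longrightarrow>
          I \<otimes>\<^bsub>Id_semigroup S\<^esub> residual S M C = \<zero>\<^bsub>Id_semigroup S\<^esub>)"
      using C by (intro bexI[of _ "A \<inter> B"]) (auto simp: Id_semigroup_def)
  qed
qed

end
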